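(* Let $\Omega$ be an infinite set and let $f:\Omega\to\Omega$ and $g:\Omega\to\Omega$ be near-bijections. If $f\equiv g$, then $\mathrm{ind}(f)=\mathrm{ind}(g)$.
   Context: For $A\subseteq\Omega$ write $A'=\Omega\setminus A$; $A$ is cofinite if $A'$ is finite. $|A|$ denotes the cardinality of a finite set $A$. For self-maps $f,g$ of $\Omega$, $f\equiv g$ (almost equal) means that $\{\omega\in\Omega: f(\omega)\neq g(\omega)\}$ is finite. A function $f:\Omega\to\Omega$ is a near-bijection if there exist cofinite subsets $A,B\subseteq\Omega$ such that $f$ restricts to a bijection $A\to B$. The monoset of $f$ is $\Omega_f=\{\omega\in\Omega:\ f^{-1}(\{f(\omega)\})=\{\omega\}\}$, where $f^{-1}(B)$ denotes the preimage of $B$. For a near-bijection $f$, both $\Omega_f'$ and $f(\Omega)'$ are finite and the index is the integer $\mathrm{ind}(f)=\big(|\Omega_f'|-|f(\Omega_f')|\big)-|f(\Omega)'|$. *)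

theory Defs
  imports Main
begin

text \<open>
  The set \<open>\<Omega>\<close> is an explicit carrier \<open>W\<close>, and a self-map of \<open>\<Omega>\<close> is a HOL function in
  \<open>W \<rightarrow> W\<close>; every notion below depends only on the values of the function on \<open>W\<close>.
\<close>

definition cofinite_in :: "'a set \<Rightarrow> 'a set \<Rightarrow> bool" where
  "cofinite_in W A \<longleftrightarrow> A \<subseteq> W \<and> finite (W - A)"

definition almost_equal :: "'a set \<Rightarrow> ('a \<Rightarrow> 'a) \<Rightarrow> ('a \<Rightarrow> 'a) \<Rightarrow> bool" where
  "almost_equal W f g \<longleftrightarrow> finite {w \<in> W. f w \<noteq> g w}"

definition near_bijection :: "'a set \<Rightarrow> ('a \<Rightarrow> 'a) \<Rightarrow> bool" where
  "near_bijection W f \<longleftrightarrow>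
     f ` W \<subseteq> W \<and> (\<exists>A B. cofinite_in W A \<and> cofinite_in W B \<and> bij_betw f A B)"

definition monoset :: "'a set \<Rightarrow> ('a \<Rightarrow> 'a) \<Rightarrow> 'a set" where
  "monoset W f = {w \<in> W. f -` {f w} \<inter> W = {w}}"

text \<open>
  The cardinalities are those of finite sets whenever \<open>f\<close> is a near-bijection of \<open>W\<close>, by the
  two lemmas after the definition.
\<close>

definition ind :: "'a set \<Rightarrow> ('a \<Rightarrow> 'a) \<Rightarrow> int" where
  "ind W f = (int (card (W - monoset W f)) - int (card (f ` (W - monoset W f))))
             - int (card (W - f ` W))"

lemma near_bijection_finite_compl_monoset:
  assumes "near_bijection W f"
  shows "finite (W - monoset W f)"
proof -
  obtain A B where A: "A \<subseteq> W" "finite (W - A)" and inj: "inj_on f A"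
    using assms unfolding near_bijection_def cofinite_in_def bij_betw_def by blast
  have "W - monoset W f \<subseteq> (W - A) \<union> (f -` (f ` (W - A)) \<inter> A)"
  proof
    fix w assume w: "w \<in> W - monoset W f"
    then obtain x where x: "x \<in> W" "f x = f w" "x \<noteq> w"
      unfolding monoset_def by auto
    show "w \<in> (W - A) \<union> (f -` (f ` (W - A)) \<inter> A)"
    proof (cases "w \<in> A")
      case True
      with x inj have "x \<in> W - A"
        by (auto dest: inj_onD)
      then have "f w \<in> f ` (W - A)"
        using x(2) by (metis imageI)
      with True show ?thesis by simp
    qed (use w in simp)
  qed
  moreover have "finite (f -` (f ` (W - A)) \<inter> A)"
    using A(2) inj by (intro finite_vimage_IntI) auto
  ultimately show ?thesis
    using A(2) finite_subset by blast
qed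

lemma near_bijection_finite_compl_image:
  assumes "near_bijection W f"
  shows "finite (W - f ` W)"
proof -
  obtain A B where "A \<subseteq> W" "finite (W - B)" "f ` A = B"
    using assms unfolding near_bijection_def cofinite_in_def bij_betw_def by blast
  moreover from this have "W - f ` W \<subseteq> W - B" by blast
  ultimately show ?thesis using finite_subset by blast
qed

end

theory Submission
  imports Defs
begin

text \<open>
  The idea is to rewrite the index as the defect \<open>|W - A| - |W - f(A)|\<close> of the restriction of
  \<open>f\<close> to a cofinite set \<open>A\<close> of its monoset. This number does not depend on \<open>A\<close>: moving a
  point \<open>x\<close> of the monoset out of \<open>A\<close> enlarges \<open>W - A\<close> by \<open>x\<close> and \<open>W - f(A)\<close> by \<open>f(x)\<close>, so the
  difference stays the same, and for \<open>A\<close> the whole monoset it is the index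
  (lemma \<open>ind_eq_defect\<close>).

  If \<open>f\<close> and \<open>g\<close> are almost equal near-bijections, then their monosets and the set where they
  agree are all cofinite, hence so is the intersection \<open>A\<close> of the three. The defects of \<open>f\<close> and of
  \<open>g\<close> on \<open>A\<close> coincide because \<open>f(A) = g(A)\<close>.
\<close>

lemma monoset_subset: "monoset W f \<subseteq> W"
  unfolding monoset_def by blast

lemma monoset_eqI:
  assumes "x \<in> monoset W f" "y \<in> W" "f x = f y"
  shows "x = y"
  using assms unfolding monoset_def by auto

lemma inj_on_monoset: "inj_on f (monoset W f)"
  using monoset_eqI monoset_subset by (metis inj_onI subsetD)

text \<open>
  No value taken on the monoset is taken anywhere else. Hence the points missed by \<open>f(A)\<close> split
  disjointly into those missed by \<open>f\<close> altogether, the values taken outside the monoset, and the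
  values taken on the rest of the monoset; the last part has as many points as that rest, which
  cancels against its contribution to \<open>W - A\<close>.
\<close>

lemma ind_eq_defect:
  assumes f: "near_bijection W f"
    and A: "A \<subseteq> monoset W f" "finite (W - A)"
  shows "ind W f = int (card (W - A)) - int (card (W - f ` A))"
proof -
  let ?M = "monoset W f"
  have fW: "f ` W \<subseteq> W"
    using f unfolding near_bijection_def by blast
  have fin_W: "finite (W - ?M)" "finite (W - f ` W)"
    using f near_bijection_finite_compl_monoset near_bijection_finite_compl_image by blast+
  have fin_M: "finite (?M - A)"
    using A(2) monoset_subset by (metis Diff_mono finite_subset order_refl)

  have "W - A = (W - ?M) \<union> (?M - A)"
    using A(1) monoset_subset by fast
  then have dom: "card (W - A) = card (W - ?M) + card (?M - A)"
    using fin_W(1) fin_M by (metis Diff_disjoint Int_Diff card_Un_disjoint inf_commute empty_Diff)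

  have "f ` W - f ` A = f ` (W - ?M) \<union> f ` (?M - A)"
  proof
    show "f ` W - f ` A \<subseteq> f ` (W - ?M) \<union> f ` (?M - A)"
      by blast
    have "f x \<notin> f ` A" if "x \<in> W - A" for x
    proof
      assume "f x \<in> f ` A"
      then obtain a where "a \<in> A" "f a = f x"
        by auto
      with that A(1) show False
        using monoset_eqI[of a W f x] by blast
    qed
    then show "f ` (W - ?M) \<union> f ` (?M - A) \<subseteq> f ` W - f ` A"
      using A(1) monoset_subset[of W f] by auto
  qed
  moreover have "W - f ` A = (W - f ` W) \<union> (f ` W - f ` A)"
    using fW A(1) monoset_subset[of W f] by blast
  ultimately have split: "W - f ` A = (W - f ` W) \<union> (f ` (W - ?M) \<union> f ` (?M - A))"
    by simp
  have disj: "f ` (W - ?M) \<inter> f ` (?M - A) = {}"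
    using monoset_eqI[of _ W f] by fastforce
  have "(W - f ` W) \<inter> (f ` (W - ?M) \<union> f ` (?M - A)) = {}"
    using monoset_subset[of W f] by blast
  then have "card (W - f ` A) = card (W - f ` W) + card (f ` (W - ?M) \<union> f ` (?M - A))"
    unfolding split using fin_W fin_M by (intro card_Un_disjoint) auto
  also have "card (f ` (W - ?M) \<union> f ` (?M - A)) = card (f ` (W - ?M)) + card (f ` (?M - A))"
    using fin_W fin_M disj by (intro card_Un_disjoint) auto
  also have "card (f ` (?M - A)) = card (?M - A)"
    using inj_on_monoset by (metis card_image inj_on_diff)
  finally show ?thesis
    unfolding ind_def dom by simp
qed

theorem theorem19:
  fixes W :: "'a set" and f g :: "'a \<Rightarrow> 'a"
  assumes "infinite W"
    and "near_bijection W f"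
    and "near_bijection W g"
    and "almost_equal W f g"
  shows "ind W f = ind W g"
proof -
  define A where "A = monoset W f \<inter> monoset W g \<inter> {w \<in> W. f w = g w}"
  have "W - A = (W - monoset W f) \<union> (W - monoset W g) \<union> {w \<in> W. f w \<noteq> g w}"
    unfolding A_def by blast
  then have fin: "finite (W - A)"
    using assms(4) near_bijection_finite_compl_monoset[OF assms(2)]
      near_bijection_finite_compl_monoset[OF assms(3)]
    unfolding almost_equal_def by simp
  have "f ` A = g ` A"
    unfolding A_def by (intro image_cong) auto
  moreover have "ind W f = int (card (W - A)) - int (card (W - f ` A))"
    using assms(2) fin by (intro ind_eq_defect) (auto simp: A_def)
  moreover have "ind W g = int (card (W - A)) - int (card (W - g ` A))"
    using assms(3) fin by (intro ind_eq_defect) (auto simp: A_def)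
  ultimately show ?thesis
    by simp
qed

end
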